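(* For every integer $k\geq 12$, the sets $$X_{k}:=\{0,1,5,6,7\}\cup\{9,10,\dots,k-4,k-3\}\cup\{k\}$$ and $$Y_{k}:=\{0,4,5,6\}\cup\{9,10,\dots,k-4,k-3\}\cup\{k-1,k\}$$ are $(k-5)$-point inequivalent homometric configurations on the line; that is, each has exactly $k-5$ points, they have the same distance spectrum $\mathcal{D}(X_k)=\mathcal{D}(Y_k)$, and they are not equivalent.
   Context: Here $\{9,10,\dots,k-3\}$ is the set of all integers $j$ with $9\le j\le k-3$. For an $n$-point configuration $X=\{x_0,\dots,x_{n-1}\}\subset\mathbb{R}$ the distance spectrum $\mathcal{D}(X)$ is the multiset $\{|x_i-x_j| : 0\le i<j\le n-1\}$, counted with multiplicities. Two configurations are homometric if they have the same distance spectrum. Two configurations are equivalent if they are related by a finite sequence of translations, dilations, and reflections of the line. *)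

theory Defs
  imports Complex_Main "HOL-Library.Multiset"
begin

definition point_configuration :: "nat \<Rightarrow> real set \<Rightarrow> bool" where
  "point_configuration n X \<longleftrightarrow> finite X \<and> card X = n"

text \<open>
  Each unordered pair of distinct points is represented by the ordered pair with the smaller point
  first, i.e. the points are enumerated increasingly; the multiset of distances does not depend on
  the enumeration. The value is only meaningful for finite sets, since \<^const>\<open>mset_set\<close> of an
  infinite set is empty.
\<close>

definition distance_spectrum :: "real set \<Rightarrow> real multiset" where
  "distance_spectrum X =
     image_mset (\<lambda>(x, y). \<bar>x - y\<bar>) (mset_set {(x, y). x \<in> X \<and> y \<in> X \<and> x < y})"

definition homometric :: "real set \<Rightarrow> real set \<Rightarrow> bool" where
  "homometric X Y \<longleftrightarrow> finite X \<and> finite Y \<and> distance_spectrum X = distance_spectrum Y"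

definition line_translation :: "(real \<Rightarrow> real) \<Rightarrow> bool" where
  "line_translation f \<longleftrightarrow> (\<exists>t. f = (\<lambda>x. x + t))"

text \<open>Dilations have an arbitrary centre \<open>a\<close> and a positive ratio \<open>c\<close>.\<close>

definition line_dilation :: "(real \<Rightarrow> real) \<Rightarrow> bool" where
  "line_dilation f \<longleftrightarrow> (\<exists>a c. c > 0 \<and> f = (\<lambda>x. a + c * (x - a)))"

definition line_reflection :: "(real \<Rightarrow> real) \<Rightarrow> bool" where
  "line_reflection f \<longleftrightarrow> (\<exists>a. f = (\<lambda>x. 2 * a - x))"

definition elementary_move :: "real set \<Rightarrow> real set \<Rightarrow> bool" where
  "elementary_move X Y \<longleftrightarrow>
     (\<exists>f. (line_translation f \<or> line_dilation f \<or> line_reflection f) \<and> Y = f ` X)"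

definition equivalent_configurations :: "real set \<Rightarrow> real set \<Rightarrow> bool" where
  "equivalent_configurations = elementary_move\<^sup>*\<^sup>*"

definition X_config :: "int \<Rightarrow> real set" where
  "X_config k = real_of_int ` ({0, 1, 5, 6, 7} \<union> {9..k - 3} \<union> {k})"

definition Y_config :: "int \<Rightarrow> real set" where
  "Y_config k = real_of_int ` ({0, 4, 5, 6} \<union> {9..k - 3} \<union> {k - 1, k})"

end

theory Submission
  imports Defs
begin

text \<open>
  The two configurations share the points \<open>C = {0, 5, 6} \<union> {9..k - 3} \<union> {k}\<close>, and are obtained by
  adding the pairs \<open>{1, 7}\<close> and \<open>{4, k - 1}\<close> respectively. Up to the distances inside \<open>C\<close>, both
  spectra consist of \<open>1, 1, 2, 4, k - 7, k - 1\<close> and the runs \<open>{2..k - 10}\<close> and \<open>{5..k - 4}\<close>.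
  An equivalence is an affine map; as both sets have convex hull \<open>[0, k]\<close>, it would have to be the
  identity or \<open>x \<mapsto> k - x\<close>. But \<open>1\<close> and \<open>k - (k - 3) = 3\<close> are not in \<open>Y\<^sub>k\<close>.
\<close>

section \<open>Distance spectra under adding one point\<close>

text \<open>Each new pair consists of \<open>a\<close> and exactly one point \<open>x\<close> of
  \<open>S\<close>, so the new pairs are in bijection with \<open>S\<close> and disjoint from the
  old ones.\<close>

lemma distance_spectrum_insert:
  assumes "finite S" "a \<notin> S"
  shows "distance_spectrum (insert a S) =
    distance_spectrum S + image_mset (\<lambda>x. \<bar>a - x\<bar>) (mset_set S)"
proof -
  let ?P = "{(x, y). x \<in> S \<and> y \<in> S \<and> x < y}"
  \<comment> \<open>The spectrum is taken over pairs with the smaller point first, so the new pair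
    is sorted here.\<close>
  let ?f = "\<lambda>x. (min a x, max a x)"
  have inj: "inj_on ?f S"
    using assms by (auto simp: inj_on_def min_def max_def split: if_splits)
  have "finite ?P"
    by (rule finite_subset[of _ "S \<times> S"]) (use assms in auto)
  moreover have "?P \<inter> ?f ` S = {}"
    using assms by (auto simp: min_def max_def split: if_splits)
  moreover have "{(x, y). x \<in> insert a S \<and> y \<in> insert a S \<and> x < y} = ?P \<union> ?f ` S"
  proof (intro equalityI subsetI)
    fix p assume "p \<in> {(x, y). x \<in> insert a S \<and> y \<in> insert a S \<and> x < y}"
    then obtain x y where p: "p = (x, y)" "x \<in> insert a S" "y \<in> insert a S" "x < y"
      by auto
    then consider "x \<in> S" "y \<in> S" | "x = a" "y \<in> S" | "y = a" "x \<in> S"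
      by blast
    then show "p \<in> ?P \<union> ?f ` S"
    proof cases
      case 2
      then have "p = ?f y" using p by simp
      with 2 show ?thesis by blast
    next
      case 3
      then have "p = ?f x" using p by simp
      with 3 show ?thesis by blast
    qed (use p in auto)
  qed (use assms in \<open>auto simp: min_def max_def order.strict_iff_order split: if_splits\<close>)
  ultimately have "mset_set {(x, y). x \<in> insert a S \<and> y \<in> insert a S \<and> x < y} =
      mset_set ?P + image_mset ?f (mset_set S)"
    using assms inj by (simp add: mset_set_Union image_mset_mset_set)
  then show ?thesis
    unfolding distance_spectrum_def
    by (auto simp: multiset.map_comp intro!: image_mset_cong)
qed

text \<open>Integer form of the previous lemma: the new distances can then be computed with integer
  intervals and cast to the reals only at the end.\<close>

lemma distance_spectrum_of_int_insert:
  fixes S :: "int set"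
  assumes "finite S" "a \<notin> S"
  shows "distance_spectrum (real_of_int ` insert a S) = distance_spectrum (real_of_int ` S) +
    image_mset real_of_int (image_mset (\<lambda>x. \<bar>a - x\<bar>) (mset_set S))"
proof -
  have "mset_set (real_of_int ` S) = image_mset real_of_int (mset_set S)"
    by (simp add: image_mset_mset_set inj_on_def)
  then show ?thesis
    using assms by (simp add: distance_spectrum_insert image_iff multiset.map_comp comp_def)
qed

text \<open>Seen from a point on one side of it, an interval yields each distance once, hence again
  an interval. The next lemma treats the other side.\<close>

lemma image_abs_diff_atLeastAtMost_left:
  fixes a m n :: int
  assumes "a \<le> m"
  shows "image_mset (\<lambda>x. \<bar>a - x\<bar>) (mset_set {m..n}) = mset_set {m - a..n - a}"
proof -
  have "(\<lambda>x. \<bar>a - x\<bar>) ` {m..n} = {m - a..n - a}"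
  proof (intro equalityI subsetI)
    fix y assume "y \<in> {m - a..n - a}"
    then show "y \<in> (\<lambda>x. \<bar>a - x\<bar>) ` {m..n}"
      using assms by (intro image_eqI[of _ _ "y + a"]) auto
  qed (use assms in auto)
  moreover have "inj_on (\<lambda>x. \<bar>a - x\<bar>) {m..n}"
    using assms by (auto simp: inj_on_def)
  ultimately show ?thesis
    by (simp add: image_mset_mset_set)
qed

lemma image_abs_diff_atLeastAtMost_right:
  fixes a m n :: int
  assumes "n \<le> a"
  shows "image_mset (\<lambda>x. \<bar>a - x\<bar>) (mset_set {m..n}) = mset_set {a - n..a - m}"
proof -
  have "(\<lambda>x. \<bar>a - x\<bar>) ` {m..n} = {a - n..a - m}"
  proof (intro equalityI subsetI)
    fix y assume "y \<in> {a - n..a - m}"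
    then show "y \<in> (\<lambda>x. \<bar>a - x\<bar>) ` {m..n}"
      using assms by (intro image_eqI[of _ _ "a - y"]) auto
  qed (use assms in auto)
  moreover have "inj_on (\<lambda>x. \<bar>a - x\<bar>) {m..n}"
    using assms by (auto simp: inj_on_def)
  ultimately show ?thesis
    by (simp add: image_mset_mset_set)
qed

section \<open>Equality of the two spectra\<close>

lemma distance_spectrum_X_config_eq_Y_config:
  assumes "k \<ge> 12"
  shows "distance_spectrum (X_config k) = distance_spectrum (Y_config k)"
proof -
  define C where "C = {0, 5, 6} \<union> {9..k - 3} \<union> {k}"
  let ?d = "\<lambda>a S. image_mset (\<lambda>x. \<bar>a - x\<bar>) (mset_set S)"
  \<comment> \<open>The second point of each pair is added to \<open>C\<close> together with the
    first, so the distances within the pairs, \<open>6\<close> and \<open>k - 5\<close>, are counted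
    there.\<close>
  have fresh: "finite C" "1 \<notin> C" "7 \<notin> insert 1 C" "4 \<notin> C" "k - 1 \<notin> insert 4 C"
    using assms by (auto simp: C_def)
  have "C = insert 0 (insert 5 (insert 6 (insert k {9..k - 3})))"
    by (auto simp: C_def)
  then have C: "mset_set C = {#0, 5, 6, k#} + mset_set {9..k - 3}"
    using assms by simp
  have X: "X_config k = real_of_int ` insert 7 (insert 1 C)"
    unfolding X_config_def C_def by (rule arg_cong[where f = "image _"]) auto
  have Y: "Y_config k = real_of_int ` insert (k - 1) (insert 4 C)"
    unfolding Y_config_def C_def by (rule arg_cong[where f = "image _"]) auto
  \<comment> \<open>The run \<open>{5..k - 4}\<close> is split at its lower end for the first
    configuration and at its upper end for the second.\<close>
  have run: "{5..k - 4} = insert 5 (insert 6 (insert 7 {8..k - 4}))"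
    "{5..k - 4} = insert (k - 4) (insert (k - 5) (insert (k - 6) {5..k - 7}))"
    using assms by auto
  have "{#5, 6, 7#} + mset_set {8..k - 4} = mset_set {5..k - 4}"
    by (subst run(1)) simp
  also have "\<dots> = {#k - 4, k - 5, k - 6#} + mset_set {5..k - 7}"
    by (subst run(2)) simp
  finally have runs: "{#5, 6, 7#} + mset_set {8..k - 4} =
    {#k - 4, k - 5, k - 6#} + mset_set {5..k - 7}" .
  \<comment> \<open>The point \<open>1\<close> contributes \<open>1, 4, 5, k - 1\<close> and
    \<open>{8..k - 4}\<close>; the point \<open>7\<close> contributes
    \<open>1, 2, 6, 7, k - 7\<close> and \<open>{2..k - 10}\<close>.\<close>
  have "?d 1 C + ?d 7 (insert 1 C) =
      {#1, 4, k - 1, 1, 2, k - 7#} + mset_set {2..k - 10} + ({#5, 6, 7#} + mset_set {8..k - 4})"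
    using assms fresh by (simp add: C image_abs_diff_atLeastAtMost_left)
  \<comment> \<open>The point \<open>4\<close> contributes \<open>1, 2, 4, k - 4\<close> and
    \<open>{5..k - 7}\<close>; the point \<open>k - 1\<close> contributes
    \<open>1, k - 7, k - 6, k - 5, k - 1\<close> and \<open>{2..k - 10}\<close>.\<close>
  also have "\<dots> = ?d 4 C + ?d (k - 1) (insert 4 C)"
    unfolding runs using assms fresh
    by (simp add: C image_abs_diff_atLeastAtMost_left image_abs_diff_atLeastAtMost_right)
  finally have "?d 1 C + ?d 7 (insert 1 C) = ?d 4 C + ?d (k - 1) (insert 4 C)" .
  then have "image_mset real_of_int (?d 1 C + ?d 7 (insert 1 C)) =
      image_mset real_of_int (?d 4 C + ?d (k - 1) (insert 4 C))"
    by (rule arg_cong)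
  moreover have "distance_spectrum (X_config k) = distance_spectrum (real_of_int ` C) +
      image_mset real_of_int (?d 1 C + ?d 7 (insert 1 C))"
    unfolding X image_mset_union
    by (simp only: distance_spectrum_of_int_insert fresh finite_insert not_False_eq_True add.assoc)
  moreover have "distance_spectrum (Y_config k) = distance_spectrum (real_of_int ` C) +
      image_mset real_of_int (?d 4 C + ?d (k - 1) (insert 4 C))"
    unfolding Y image_mset_union
    by (simp only: distance_spectrum_of_int_insert fresh finite_insert not_False_eq_True add.assoc)
  ultimately show ?thesis
    by (simp only:)
qed

section \<open>Equivalences as affine maps, and inequivalence\<close>

lemma elementary_move_affine:
  assumes "elementary_move X Y"
  obtains a b where "Y = (\<lambda>x. a * x + b) ` X"
proof -
  obtain f where f: "line_translation f \<or> line_dilation f \<or> line_reflection f" "Y = f ` X"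
    using assms unfolding elementary_move_def by blast
  from f(1) have "\<exists>a b. f = (\<lambda>x. a * x + b)"
  proof (elim disjE)
    assume "line_translation f"
    then obtain t where "f = (\<lambda>x. 1 * x + t)"
      unfolding line_translation_def by auto
    then show ?thesis by blast
  next
    assume "line_dilation f"
    then obtain a c where "f = (\<lambda>x. a + c * (x - a))"
      unfolding line_dilation_def by blast
    then have "f = (\<lambda>x. c * x + (a - c * a))"
      by (simp add: algebra_simps)
    then show ?thesis by blast
  next
    assume "line_reflection f"
    then obtain a where "f = (\<lambda>x. (-1) * x + 2 * a)"
      unfolding line_reflection_def by auto
    then show ?thesis by blast
  qed
  with f(2) that show thesis by blast
qed

text \<open>Affine maps are closed under composition, so a chain of moves of any length collapses to
  a single one.\<close>

lemma equivalent_configurations_affine: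
  assumes "equivalent_configurations X Y"
  shows "\<exists>a b. Y = (\<lambda>x. a * x + b) ` X"
  using assms unfolding equivalent_configurations_def
proof (induction rule: rtranclp_induct)
  case base
  have "X = (\<lambda>x. 1 * x + 0) ` X" by simp
  then show ?case by blast
next
  case (step Y Z)
  obtain a b where "Y = (\<lambda>x. a * x + b) ` X"
    using step.IH by blast
  moreover obtain c d where "Z = (\<lambda>x. c * x + d) ` Y"
    using step.hyps(2) by (rule elementary_move_affine)
  ultimately have "Z = (\<lambda>x. (c * a) * x + (c * b + d)) ` X"
    by (simp add: image_image algebra_simps)
  then show ?case by blast
qed

text \<open>A monotone map takes its extreme values at the endpoints. Since \<open>0\<close> and
  \<open>r\<close> are both attained and no value leaves \<open>{0..r}\<close>, the endpoints are
  fixed or swapped according to the sign of \<open>a\<close>.\<close>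

lemma affine_image_same_hull:
  fixes X Y :: "real set"
  assumes "Y = (\<lambda>x. a * x + b) ` X"
    and "X \<subseteq> {0..r}" "Y \<subseteq> {0..r}" "{0, r} \<subseteq> X" "{0, r} \<subseteq> Y" "r > 0"
  shows "a = 1 \<and> b = 0 \<or> a = -1 \<and> b = r"
proof -
  have "a * 0 + b \<in> Y" "a * r + b \<in> Y"
    unfolding assms(1) using assms(4) by blast+
  then have b: "0 \<le> b" "b \<le> r" "0 \<le> a * r + b" "a * r + b \<le> r"
    using assms(3) by auto
  have "0 \<in> Y" "r \<in> Y"
    using assms(5) by simp_all
  then obtain x y where "x \<in> X" "y \<in> X" "a * x + b = 0" "a * y + b = r"
    unfolding assms(1) by (elim imageE) simp
  then have xy: "x \<in> {0..r}" "y \<in> {0..r}" "a * x + b = 0" "a * y + b = r"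
    using assms(2) by auto
  show ?thesis
  proof (cases "a \<ge> 0")
    case True
    then have "0 \<le> a * x" "a * y \<le> a * r"
      using xy by (auto intro: mult_left_mono)
    then have "b = 0" "a * r = r"
      using b xy by linarith+
    with assms(6) show ?thesis by simp
  next
    case False
    then have "a * y \<le> 0" "a * r \<le> a * x"
      using xy by (auto simp: mult_le_0_iff mult_left_mono_neg)
    then have "b = r" "a * r = - r"
      using b xy by linarith+
    with assms(6) have "a = -1"
      by (metis mult_cancel_right mult_minus1 less_irrefl)
    with \<open>b = r\<close> show ?thesis by simp
  qed
qed

lemma not_equivalent_X_config_Y_config:
  assumes "k \<ge> 12"
  shows "\<not> equivalent_configurations (X_config k) (Y_config k)"
proof
  assume "equivalent_configurations (X_config k) (Y_config k)"
  then obtain a b where Y: "Y_config k = (\<lambda>x. a * x + b) ` X_config k"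
    using equivalent_configurations_affine by blast
  have mem: "real_of_int i \<in> Y_config k \<longleftrightarrow> i \<in> {0, 4, 5, 6} \<union> {9..k - 3} \<union> {k - 1, k}" for i
    unfolding Y_config_def by (rule inj_image_mem_iff) (simp add: inj_on_def)
  \<comment> \<open>The points \<open>0\<close> and \<open>k\<close> pin down the hull;
    \<open>1\<close> and \<open>k - 3\<close> are the witnesses against the identity and the
    reflection.\<close>
  have X: "{0, 1, real_of_int k, real_of_int (k - 3)} \<subseteq> X_config k"
  proof -
    have "real_of_int ` {0, 1, k, k - 3} \<subseteq> X_config k"
      unfolding X_config_def using assms by (intro image_mono) auto
    then show ?thesis by simp
  qed
  have "a = 1 \<and> b = 0 \<or> a = -1 \<and> b = real_of_int k"
    by (rule affine_image_same_hull[OF Y])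
      (use assms X in \<open>auto simp: X_config_def Y_config_def\<close>)
  then show False
  proof (elim disjE conjE)
    assume "a = 1" "b = 0"
    then have "real_of_int 1 \<in> Y_config k"
      using X Y by auto
    with mem[of 1] assms show False by simp
  next
    assume "a = -1" "b = real_of_int k"
    then have "real_of_int 3 \<in> Y_config k"
      using X unfolding Y by (intro image_eqI[of _ _ "real_of_int (k - 3)"]) auto
    with mem[of 3] assms show False by simp
  qed
qed

section \<open>Cardinalities and conclusion\<close>

lemma point_configuration_X_config:
  assumes "k \<ge> 12"
  shows "point_configuration (nat (k - 5)) (X_config k)"
proof -
  \<comment> \<open>There are six isolated entries and \<open>k - 11\<close> points in the interval,
    which gives \<open>k - 5\<close>.\<close>
  have "card (X_config k) = card (insert 0 (insert 1 (insert 5 (insert 6 (insert 7 (insert k {9..k - 3}))))))"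
    unfolding X_config_def by (subst card_image) (auto simp: inj_on_def intro!: arg_cong[where f = card])
  also have "\<dots> = nat (k - 5)"
    using assms by (simp add: card_insert_if)
  finally show ?thesis
    by (simp add: point_configuration_def X_config_def)
qed

lemma point_configuration_Y_config:
  assumes "k \<ge> 12"
  shows "point_configuration (nat (k - 5)) (Y_config k)"
proof -
  have "card (Y_config k) = card (insert 0 (insert 4 (insert 5 (insert 6 (insert (k - 1) (insert k {9..k - 3}))))))"
    unfolding Y_config_def by (subst card_image) (auto simp: inj_on_def intro!: arg_cong[where f = card])
  also have "\<dots> = nat (k - 5)"
    using assms by (simp add: card_insert_if)
  finally show ?thesis
    by (simp add: point_configuration_def Y_config_def)
qed

theorem proposition4p1:
  fixes k :: int
  assumes "k \<ge> 12"
  shows "point_configuration (nat (k - 5)) (X_config k)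
    \<and> point_configuration (nat (k - 5)) (Y_config k)
    \<and> homometric (X_config k) (Y_config k)
    \<and> \<not> equivalent_configurations (X_config k) (Y_config k)"
proof -
  have "finite (X_config k)" "finite (Y_config k)"
    by (simp_all add: X_config_def Y_config_def)
  then show ?thesis
    using assms by (simp add: homometric_def point_configuration_X_config
        point_configuration_Y_config distance_spectrum_X_config_eq_Y_config
        not_equivalent_X_config_Y_config)
qed

end
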